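(* Let $d\ge 1$ and $T\ge 1$ be integers, let $c$ be a fixed prompt (condition), and let $\theta$ be the parameters of a flow model. Let $\mathbf{x}_T,\mathbf{x}_{T-1},\dots,\mathbf{x}_0$ be random vectors in $\mathbb{R}^d$ generated by $\mathbf{x}_T\sim\mathcal{N}(\mathbf{0},\mathbf{I})$ and, for each $t\in\{1,\dots,T\}$, by the reverse-time transition $$\mathbf{x}_{t-1}=\mu_\theta(\mathbf{x}_t,t,c)+\sigma_t\sqrt{\mathrm{d}t}\,\boldsymbol{\epsilon},\qquad \boldsymbol{\epsilon}\sim\mathcal{N}(\mathbf{0},\mathbf{I}),$$ where the noise $\boldsymbol{\epsilon}$ at each step is independent of $\mathbf{x}_T,\dots,\mathbf{x}_t$; that is, the conditional density is $p_\theta(\mathbf{x}_{t-1}\mid\mathbf{x}_t,c)=\mathcal{N}(\mathbf{x}_{t-1};\mu_\theta(\mathbf{x}_t,t,c),\sigma_t^2\,\mathrm{d}t\,\mathbf{I})$. Here $\sigma_t>0$ and $\mathrm{d}t>0$ are fixed by the noise schedule and do not depend on $\theta$. Define the per-step conditional entropy at timestep $t$ by $$\mathcal{H}_t(p_\theta)=-\mathbb{E}_{\{\mathbf{x}_\tau\}_{\tau=0}^{T}\sim p_\theta(\cdot\mid c)}\big[\log p_\theta(\mathbf{x}_{t-1}\mid\mathbf{x}_t,c)\big].$$ Then, for every $t\in\{1,\dots,T\}$, $$\mathcal{H}_t(p_\theta)=\frac{d}{2}-C_t,\qquad\text{where } C_t=-\frac{d}{2}\log\big(2\pi\sigma_t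^2\,\mathrm{d}t\big).$$
   Context: The mean function $\mu_\theta(\cdot,t,c):\mathbb{R}^d\to\mathbb{R}^d$ is the one induced by the learned (measurable) velocity field $v_\theta$ of the flow model: $$\mu_\theta(\mathbf{x}_t,t,c)=\mathbf{x}_t+\Big[v_\theta(\mathbf{x}_t,t,c)+\frac{\sigma_t^2}{2t}\big(\mathbf{x}_t+(1-t)v_\theta(\mathbf{x}_t,t,c)\big)\Big]\mathrm{d}t,$$ where inside this formula $t$ is the flow time attached to the step and $\mathrm{d}t$ is a positive real number (the step size), not a differential. The notation $\mathcal{N}(\mathbf{x};\mathbf{m},\Sigma)$ is the Gaussian density with mean $\mathbf{m}$ and covariance $\Sigma$ evaluated at $\mathbf{x}$, and $p_\theta(\cdot\mid c)$ also denotes the joint law of the trajectory $(\mathbf{x}_0,\dots,\mathbf{x}_T)$. The log-density of the transition is $$\log p_\theta(\mathbf{x}_{t-1}\mid\mathbf{x}_t,c)=-\frac{\|\mathbf{x}_{t-1}-\mu_\theta(\mathbf{x}_t,t,c)\|^2}{2\sigma_t^2\,\mathrm{d}t}+C_t .$$ *)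

theory Defs
  imports "HOL-Probability.Probability"
begin

definition gaussian_density :: "real ^ 'n \<Rightarrow> real ^ 'n ^ 'n \<Rightarrow> real ^ 'n \<Rightarrow> real" where
  "gaussian_density m S x =
     exp (- ((x - m) \<bullet> (matrix_inv S *v (x - m))) / 2) / sqrt ((2 * pi) ^ CARD('n) * det S)"

(* Steps are indexed by naturals; s t is the (real) flow time attached to step t and h t is the
   step size of that step.  The velocity field is evaluated at flow times. *)

definition flow_mean ::
  "('p \<Rightarrow> real ^ 'n \<Rightarrow> real \<Rightarrow> 'c \<Rightarrow> real ^ 'n) \<Rightarrow> (nat \<Rightarrow> real) \<Rightarrow> (nat \<Rightarrow> real) \<Rightarrow> (nat \<Rightarrow> real)
    \<Rightarrow> 'p \<Rightarrow> real ^ 'n \<Rightarrow> nat \<Rightarrow> 'c \<Rightarrow> real ^ 'n" where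
  "flow_mean v s \<sigma> h \<theta> x t c =
     x + h t *\<^sub>R (v \<theta> x (s t) c +
       ((\<sigma> t)\<^sup>2 / (2 * s t)) *\<^sub>R (x + (1 - s t) *\<^sub>R v \<theta> x (s t) c))"

(* The density of x_(t-1) at y given x_t = x; mat k is the scalar matrix k I. *)
definition transition_density ::
  "('p \<Rightarrow> real ^ 'n \<Rightarrow> real \<Rightarrow> 'c \<Rightarrow> real ^ 'n) \<Rightarrow> (nat \<Rightarrow> real) \<Rightarrow> (nat \<Rightarrow> real) \<Rightarrow> (nat \<Rightarrow> real)
    \<Rightarrow> 'p \<Rightarrow> 'c \<Rightarrow> nat \<Rightarrow> real ^ 'n \<Rightarrow> real ^ 'n \<Rightarrow> real" where
  "transition_density v s \<sigma> h \<theta> c t x y =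
     gaussian_density (flow_mean v s \<sigma> h \<theta> x t c) (mat ((\<sigma> t)\<^sup>2 * h t)) y"

definition trajectory_law ::
  "'w measure \<Rightarrow> nat \<Rightarrow> (nat \<Rightarrow> 'w \<Rightarrow> real ^ 'n) \<Rightarrow> (nat \<Rightarrow> real ^ 'n) measure" where
  "trajectory_law M T X =
     distr M (Pi\<^sub>M {0..T} (\<lambda>_. borel)) (\<lambda>\<omega>. \<lambda>\<tau>\<in>{0..T}. X \<tau> \<omega>)"

definition step_log_density ::
  "('p \<Rightarrow> real ^ 'n \<Rightarrow> real \<Rightarrow> 'c \<Rightarrow> real ^ 'n) \<Rightarrow> (nat \<Rightarrow> real) \<Rightarrow> (nat \<Rightarrow> real) \<Rightarrow> (nat \<Rightarrow> real)
    \<Rightarrow> 'p \<Rightarrow> 'c \<Rightarrow> nat \<Rightarrow> (nat \<Rightarrow> real ^ 'n) \<Rightarrow> real" where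
  "step_log_density v s \<sigma> h \<theta> c t x = ln (transition_density v s \<sigma> h \<theta> c t (x t) (x (t - 1)))"

(* P is the joint law of the trajectory. *)
definition step_entropy ::
  "('p \<Rightarrow> real ^ 'n \<Rightarrow> real \<Rightarrow> 'c \<Rightarrow> real ^ 'n) \<Rightarrow> (nat \<Rightarrow> real) \<Rightarrow> (nat \<Rightarrow> real) \<Rightarrow> (nat \<Rightarrow> real)
    \<Rightarrow> 'p \<Rightarrow> 'c \<Rightarrow> (nat \<Rightarrow> real ^ 'n) measure \<Rightarrow> nat \<Rightarrow> real" where
  "step_entropy v s \<sigma> h \<theta> c P t = - (\<integral>x. step_log_density v s \<sigma> h \<theta> c t x \<partial>P)"

definition log_norm_const :: "nat \<Rightarrow> (nat \<Rightarrow> real) \<Rightarrow> (nat \<Rightarrow> real) \<Rightarrow> nat \<Rightarrow> real" where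
  "log_norm_const d \<sigma> h t = - (real d / 2) * ln (2 * pi * (\<sigma> t)\<^sup>2 * h t)"

end

theory Submission
  imports Defs
begin

text \<open>Along the trajectory the residual of a step is the scaled noise, so the step log-density is
  almost surely the normalising constant minus half the squared norm of a standard Gaussian vector.
  That squared norm has expectation equal to the dimension, by Fubini and the one-dimensional
  second moment.\<close>

lemma det_mat: "det (mat k :: 'a::comm_ring_1 ^ 'n ^ 'n) = k ^ CARD('n)"
  by (subst det_diagonal) (auto simp: mat_def)

lemma mat_vector_mult: "mat k *v x = k *\<^sub>R (x :: real ^ 'n)"
  by (simp add: vec_eq_iff matrix_vector_mult_def mat_def if_distrib[of "\<lambda>a. a * _"] cong: if_cong)

text \<open>\<open>matrix_inv\<close> is a choice operator, so uniqueness is needed besides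
  existence: multiplying any two-sided inverse \<open>B\<close> by
  \<open>mat k ** mat (inverse k)\<close> and reassociating forces
  \<open>B = mat (inverse k)\<close>.\<close>

lemma matrix_inv_mat:
  assumes "(k::real) \<noteq> 0"
  shows "matrix_inv (mat k :: real ^ 'n ^ 'n) = mat (inverse k)"
proof -
  have "mat a ** mat b = (mat (a * b) :: real ^ 'n ^ 'n)" for a b
    by (simp add: vec_eq_iff matrix_matrix_mult_def mat_def if_distrib[of "\<lambda>a. a * _"] cong: if_cong)
  then have inv: "mat k ** mat (inverse k) = (mat 1 :: real ^ 'n ^ 'n)"
      "mat (inverse k) ** mat k = (mat 1 :: real ^ 'n ^ 'n)"
    using assms by simp_all
  show ?thesis
    unfolding matrix_inv_def
  proof (rule some_equality)
    fix B :: "real ^ 'n ^ 'n"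
    assume "mat k ** B = mat 1 \<and> B ** mat k = mat 1"
    then have "B ** (mat k ** mat (inverse k)) = mat (inverse k)"
      by (simp add: matrix_mul_assoc)
    then show "B = mat (inverse k)"
      by (simp add: inv)
  qed (simp add: inv)
qed

lemma gaussian_density_scalar:
  assumes "k > 0"
  shows "gaussian_density m (mat k) (x :: real ^ 'n) =
    exp (- (norm (x - m))\<^sup>2 / (2 * k)) / sqrt ((2 * pi * k) ^ CARD('n))"
  using assms
  by (simp add: gaussian_density_def matrix_inv_mat mat_vector_mult det_mat power2_norm_eq_inner
      power_mult_distrib divide_simps)

text \<open>The square root in the normalising factor produces the 1/2 in front of the dimension;
  the second summand is the constant $C_t$ of the theorem.\<close>

lemma ln_gaussian_density_scalar:
  assumes "k > 0"
  shows "ln (gaussian_density m (mat k) (x :: real ^ 'n)) =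
    - (norm (x - m))\<^sup>2 / (2 * k) - real CARD('n) / 2 * ln (2 * pi * k)"
  using assms
  by (simp add: gaussian_density_scalar ln_div ln_sqrt ln_realpow)

text \<open>Factorising over the coordinates is what makes the integral against this density
  accessible to Fubini.\<close>

lemma gaussian_density_standard:
  "gaussian_density 0 (mat 1) (x :: real ^ 'n) = (\<Prod>b\<in>Basis. std_normal_density (x \<bullet> b))"
proof -
  have "(\<Prod>b\<in>Basis. std_normal_density (x \<bullet> b)) =
      exp (\<Sum>b\<in>Basis. - (x \<bullet> b)\<^sup>2 / 2) / sqrt (2 * pi) ^ CARD('n)"
    by (simp add: std_normal_density_def prod_dividef exp_sum power_one_over)
  also have "(\<Sum>b\<in>Basis. - (x \<bullet> b)\<^sup>2 / 2) = - (norm x)\<^sup>2 / 2"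
    unfolding power2_norm_eq_inner euclidean_inner[of x x]
    by (simp add: power2_eq_square sum_negf sum_divide_distrib)
  finally show ?thesis
    using real_sqrt_power[of "2 * pi" "CARD('n)"] gaussian_density_scalar[of 1 0 x] by simp
qed

text \<open>The squared norm splits into squared coordinates, each contributing 1. Using the
  nonnegative integral avoids integrability side conditions; its finite value yields integrability
  later.\<close>

lemma nn_integral_norm_power2_std_normal:
  "(\<integral>\<^sup>+x. ennreal ((\<Prod>b\<in>Basis. std_normal_density (x \<bullet> b)) * (norm x)\<^sup>2)
     \<partial>(lborel :: 'a::euclidean_space measure)) = DIM('a)"
proof -
  \<comment> \<open>The moment of order \<open>2 * k\<close> is
    \<open>fact (2 * k) / (2 ^ k * fact k)\<close>, which is 1 both for total mass
    (\<open>k = 0\<close>) and for variance (\<open>k = 1\<close>).\<close>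
  have one: "(\<integral>\<^sup>+x. ennreal (std_normal_density x) \<partial>lborel) = 1"
    using std_normal_moment_even[of 0]
    by (subst nn_integral_eq_integral) (auto simp: has_bochner_integral_iff)
  have two: "(\<integral>\<^sup>+x. ennreal (std_normal_density x * x\<^sup>2) \<partial>lborel) = 1"
    using std_normal_moment_even[of 1]
    by (subst nn_integral_eq_integral) (auto simp: has_bochner_integral_iff)
  have coord: "(\<integral>\<^sup>+x. ennreal ((\<Prod>b\<in>Basis. std_normal_density (x \<bullet> b)) * (x \<bullet> i)\<^sup>2)
      \<partial>(lborel :: 'a measure)) = 1" if i: "i \<in> Basis" for i :: 'a
  proof -
    \<comment> \<open>The weight \<open>(x \<bullet> i)\<^sup>2\<close> is absorbed into the factor
      of index \<open>i\<close>, so the integrand stays a product of one-variable functions. The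
      factor at \<open>i\<close> then integrates to the second moment, every other one to the total
      mass.\<close>
    let ?g = "\<lambda>b y. std_normal_density y * (if b = i then y\<^sup>2 else 1)"
    have "(\<Prod>b\<in>Basis. std_normal_density (x \<bullet> b)) * (x \<bullet> i)\<^sup>2 = (\<Prod>b\<in>Basis. ?g b (x \<bullet> b))" for x :: 'a
      using i by (simp add: prod.distrib prod.delta)
    then have "(\<integral>\<^sup>+x. ennreal ((\<Prod>b\<in>Basis. std_normal_density (x \<bullet> b)) * (x \<bullet> i)\<^sup>2)
        \<partial>(lborel :: 'a measure)) = (\<integral>\<^sup>+x. (\<Prod>b\<in>Basis. ennreal (?g b (x \<bullet> b))) \<partial>lborel)"
      by (simp add: prod_ennreal)
    also have "\<dots> = (\<Prod>b\<in>Basis. (\<integral>\<^sup>+y. ennreal (?g b y) \<partial>lborel))"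
      by (rule nn_integral_lborel_prod) auto
    also have "\<dots> = 1"
      proof (intro prod.neutral ballI)
      show "(\<integral>\<^sup>+y. ennreal (?g b y) \<partial>lborel) = 1" for b
        using one two by (cases "b = i") simp_all
    qed
    finally show ?thesis .
  qed
  have "ennreal ((\<Prod>b\<in>Basis. std_normal_density (x \<bullet> b)) * (norm x)\<^sup>2) =
      (\<Sum>i\<in>Basis. ennreal ((\<Prod>b\<in>Basis. std_normal_density (x \<bullet> b)) * (x \<bullet> i)\<^sup>2))" for x :: 'a
    unfolding power2_norm_eq_inner euclidean_inner[of x x]
    by (subst sum_ennreal) (auto simp: prod_nonneg power2_eq_square sum_distrib_left)
  then show ?thesis
    by (simp add: nn_integral_sum coord ennreal_of_nat_eq_real_of_nat)
qed

lemma has_bochner_integral_norm_power2_standard_gaussian: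
  fixes \<epsilon> :: "'w \<Rightarrow> real ^ 'n"
  assumes "distributed M lborel \<epsilon> (\<lambda>x. ennreal (gaussian_density 0 (mat 1) x))"
  shows "has_bochner_integral M (\<lambda>\<omega>. (norm (\<epsilon> \<omega>))\<^sup>2) (real CARD('n))"
proof (rule has_bochner_integral_nn_integral)
  have [measurable]: "\<epsilon> \<in> borel_measurable M"
    using distributed_measurable[OF assms] by simp
  show "(\<lambda>\<omega>. (norm (\<epsilon> \<omega>))\<^sup>2) \<in> borel_measurable M"
    by measurable
  have "(\<integral>\<^sup>+\<omega>. ennreal ((norm (\<epsilon> \<omega>))\<^sup>2) \<partial>M) =
      (\<integral>\<^sup>+x. ennreal (gaussian_density 0 (mat 1) (x :: real ^ 'n)) * ennreal ((norm x)\<^sup>2) \<partial>lborel)"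
    by (rule distributed_nn_integral[OF assms, symmetric]) simp
  also have "\<dots> = ennreal (real CARD('n))"
    using nn_integral_norm_power2_std_normal[where 'a="real ^ 'n"]
    by (simp add: gaussian_density_standard ennreal_mult'' ennreal_of_nat_eq_real_of_nat)
  finally show "(\<integral>\<^sup>+\<omega>. ennreal ((norm (\<epsilon> \<omega>))\<^sup>2) \<partial>M) = ennreal (real CARD('n))" .
qed auto

theorem mainTheorem1:
  fixes M :: "'w measure"
    and v :: "'p \<Rightarrow> real ^ 'n \<Rightarrow> real \<Rightarrow> 'c \<Rightarrow> real ^ 'n"
    and \<theta> :: 'p and c :: 'c
    and T :: nat
    and s \<sigma> h :: "nat \<Rightarrow> real"
    and X \<epsilon> :: "nat \<Rightarrow> 'w \<Rightarrow> real ^ 'n"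
  assumes "prob_space M"
    and "T \<ge> 1"
    and "\<And>t. t \<in> {1..T} \<Longrightarrow> \<sigma> t > 0"
    and "\<And>t. t \<in> {1..T} \<Longrightarrow> h t > 0"
    and "\<And>t. t \<in> {1..T} \<Longrightarrow> s t > 0"
    and "\<And>t. t \<in> {1..T} \<Longrightarrow> (\<lambda>x. v \<theta> x (s t) c) \<in> borel_measurable borel"
    and "\<And>t. t \<in> {0..T} \<Longrightarrow> X t \<in> borel_measurable M"
    and "distributed M lborel (X T) (\<lambda>x. ennreal (gaussian_density 0 (mat 1) x))"
    and "\<And>t. t \<in> {1..T} \<Longrightarrow>
           distributed M lborel (\<epsilon> t) (\<lambda>x. ennreal (gaussian_density 0 (mat 1) x))"
    and "\<And>t. t \<in> {1..T} \<Longrightarrow>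
           prob_space.indep_set M
             (sets (vimage_algebra (space M) (\<epsilon> t) borel))
             (sets (vimage_algebra (space M) (\<lambda>\<omega>. \<lambda>\<tau>\<in>{t..T}. X \<tau> \<omega>)
                (Pi\<^sub>M {t..T} (\<lambda>_. borel))))"
    and "\<And>t. t \<in> {1..T} \<Longrightarrow>
           AE \<omega> in M. X (t - 1) \<omega> =
             flow_mean v s \<sigma> h \<theta> (X t \<omega>) t c + (\<sigma> t * sqrt (h t)) *\<^sub>R \<epsilon> t \<omega>"
  shows "\<forall>t \<in> {1..T}.
           integrable (trajectory_law M T X) (step_log_density v s \<sigma> h \<theta> c t) \<and>
           step_entropy v s \<sigma> h \<theta> c (trajectory_law M T X) t
             = real CARD('n) / 2 - log_norm_const CARD('n) \<sigma> h t"
proof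
  fix t assume t: "t \<in> {1..T}"
  \<comment> \<open>The variance of each coordinate of the transition, whose covariance is
    \<open>mat k\<close>.\<close>
  define k where "k = (\<sigma> t)\<^sup>2 * h t"
  have "\<sigma> t > 0" "h t > 0"
    using assms(3,4) t by auto
  then have k: "k > 0"
    by (simp add: k_def)
  let ?P = "Pi\<^sub>M {0..T} (\<lambda>_. borel :: (real ^ 'n) measure)"
  let ?traj = "\<lambda>\<omega>. \<lambda>\<tau>\<in>{0..T}. X \<tau> \<omega>"
  let ?f = "step_log_density v s \<sigma> h \<theta> c t"
  let ?C = "log_norm_const CARD('n) \<sigma> h t"
  have C: "?C = - (real CARD('n) / 2) * ln (2 * pi * k)"
    by (simp add: log_norm_const_def k_def mult.assoc)
  have f: "?f x = - (norm (x (t - 1) - flow_mean v s \<sigma> h \<theta> (x t) t c))\<^sup>2 / (2 * k) + ?C" for x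
    unfolding step_log_density_def transition_density_def k_def[symmetric]
      ln_gaussian_density_scalar[OF k] C by simp
  have traj: "?traj \<in> measurable M ?P"
    using assms(7) by (intro measurable_restrict) auto
  have [measurable]: "(\<lambda>x. v \<theta> x (s t) c) \<in> borel_measurable borel"
    using assms(6) t by blast
  have [measurable]: "(\<lambda>x. x t) \<in> measurable ?P borel" "(\<lambda>x. x (t - 1)) \<in> measurable ?P borel"
    using t by (auto intro!: measurable_component_singleton)
  \<comment> \<open>Needed to pull integrals over the trajectory law back to \<open>M\<close>. At
    step \<open>t\<close> the flow time \<open>s t\<close> is fixed, so measurability of the
    velocity in its space argument suffices.\<close>
  have f_meas: "?f \<in> borel_measurable ?P"
    unfolding f flow_mean_def by measurable
  have "has_bochner_integral M (\<lambda>\<omega>. (norm (\<epsilon> t \<omega>))\<^sup>2) (real CARD('n))"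
    using assms(9) t by (intro has_bochner_integral_norm_power2_standard_gaussian)
  \<comment> \<open>The constant integrates to itself because \<open>M\<close> has total mass
    1.\<close>
  then have eps: "has_bochner_integral M (\<lambda>\<omega>. - (norm (\<epsilon> t \<omega>))\<^sup>2 / 2 + ?C)
      (- real CARD('n) / 2 + ?C)"
    using prob_space.prob_space[OF assms(1)] prob_space.finite_measure[OF assms(1)]
    by (auto simp: has_bochner_integral_iff finite_measure.integrable_const)
  have ae: "AE \<omega> in M. ?f (?traj \<omega>) = - (norm (\<epsilon> t \<omega>))\<^sup>2 / 2 + ?C"
    using assms(11)[OF t]
  proof eventually_elim
    case (elim \<omega>)
    \<comment> \<open>The residual is \<open>\<epsilon> t \<omega>\<close> scaled by
      \<open>\<sigma> t * sqrt (h t)\<close>, whose square is \<open>k\<close>; this cancels the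
      \<open>k\<close> in the exponent, so the schedule survives only in the constant.\<close>
    then have "(norm (X (t - 1) \<omega> - flow_mean v s \<sigma> h \<theta> (X t \<omega>) t c))\<^sup>2 = k * (norm (\<epsilon> t \<omega>))\<^sup>2"
      using \<open>h t > 0\<close> by (simp add: k_def power_mult_distrib)
    then show ?case
      \<comment> \<open>Both \<open>t\<close> and \<open>t - 1\<close> lie in \<open>{0..T}\<close>,
        so the restricted trajectory takes the values of \<open>X\<close> there and not
        \<open>undefined\<close>.\<close>
      using t k le_trans[OF diff_le_self, of t T 1] by (simp add: f)
  qed
  have traj_f: "(\<lambda>\<omega>. ?f (?traj \<omega>)) \<in> borel_measurable M"
    using measurable_compose[OF traj f_meas] .
  have "has_bochner_integral M (\<lambda>\<omega>. ?f (?traj \<omega>)) (- real CARD('n) / 2 + ?C)"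
    using eps has_bochner_integral_cong_AE[OF traj_f _ ae] by (auto simp: has_bochner_integral_iff)
  \<comment> \<open>Change of variables: the trajectory law is the image of \<open>M\<close> under
    the trajectory map.\<close>
  then have "has_bochner_integral (trajectory_law M T X) ?f (- real CARD('n) / 2 + ?C)"
    unfolding trajectory_law_def has_bochner_integral_iff
    by (simp add: integrable_distr_eq[OF traj f_meas] integral_distr[OF traj f_meas])
  then show "integrable (trajectory_law M T X) ?f \<and>
      step_entropy v s \<sigma> h \<theta> c (trajectory_law M T X) t = real CARD('n) / 2 - ?C"
    by (simp add: step_entropy_def has_bochner_integral_iff)
qed

end
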